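(* For every algorithm $\mathcal{A}$ (in the exploration model described in the context) and every natural number $n$ such that $\mathcal{A}$ successfully explores all connected graphs with exactly $n$ vertices, there is a connected graph $G$ with $n$ vertices such that $\mathcal{A}$ uses at least $n-3$ colors on $G$.
   Context: Exploration model. Graphs are finite, simple, undirected and connected; vertices are anonymous and edges carry no port labels. Each vertex carries a color in $\mathbb{N}=\{0,1,2,\dots\}$, where $0$ means "uncolored"; initially all vertices have color $0$. An algorithm is a function $\mathrm{move}$ mapping every environment $(c_0,E)$ — where $c_0\in\mathbb{N}$ is the color of the agent's current vertex and $E:\mathbb{N}\to\mathbb{N}$ (zero almost everywhere) gives, for each color $c$, the number $E(c)$ of neighbors of the current vertex having color $c$ — either to $\mathrm{Stop}$ or to a pair $(c_1,d)\in\mathbb{N}\times\mathbb{N}$ with $E(d)>0$, subject to $c_1=c_0$ whenever $c_0\neq 0$ (a vertex may only be colored while it is uncolored). A run on a graph $G$: an adversary chooses a start vertex $v_0$ and places the agent there; in each step, with the agent at $v$, $\mathrm{move}$ is evaluated at the environment of $v$; if the value is $\mathrm{Stop}$ the run ends, and if it is $(c_1,d)$ then $v$ receives color $c_1$ and the adversary chooses an arbitrary neighbor of $v$ of color $d$, to which the agent moves. The agent has no other memory. A vertex is visited if the agent is located at it in some step. An algorithm successfully explores $G$ if for every adversary (every choice of start vertex and of neighbors), after finitely many steps all vertices have been visited, the agent is at $v_0$, and the decision is $\mathrm{Stop}$. The number of colors used in a run is the number of distinct nonzero colors assigned during the run; $\mathcal{A}$ uses at least $m$ colors on $G$ if some run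 of $\mathcal{A}$ on $G$ (for some adversary) uses at least $m$ colors. *)

theory Defs
  imports "Graph_Theory.Digraph_Component"
begin

(* Undirected graphs are symmetric digraphs: pair_graph says finite, symmetric, loop-free,
   and parallel arcs cannot occur because an arc is a pair of vertices. The library's
   connected also demands a nonempty vertex set. *)
definition connected_graph :: "'v pair_pre_digraph \<Rightarrow> bool" where
  "connected_graph G \<longleftrightarrow> pair_graph G \<and> connected (with_proj G)"

(* Color 0 means "uncolored". In Go c d, c is the new color of the current vertex and d is the
   color of the neighbor to move to. *)
datatype decision = Stop | Go nat nat

type_synonym algorithm = "nat \<Rightarrow> (nat \<Rightarrow> nat) \<Rightarrow> decision"

(* Environments are the pairs (c0, E) with E zero almost everywhere; the values of an algorithm
   at functions E of infinite support are irrelevant, and no run on a finite graph evaluates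
   them. *)
definition exploration_algorithm :: "algorithm \<Rightarrow> bool" where
  "exploration_algorithm move \<longleftrightarrow>
     (\<forall>c0 E c1 d. finite {c. E c \<noteq> 0} \<longrightarrow> move c0 E = Go c1 d \<longrightarrow>
        E d > 0 \<and> (c0 \<noteq> 0 \<longrightarrow> c1 = c0))"

type_synonym 'v config = "'v \<times> ('v \<Rightarrow> nat)"

definition neighbor_colors :: "'v pair_pre_digraph \<Rightarrow> 'v config \<Rightarrow> nat \<Rightarrow> nat" where
  "neighbor_colors G = (\<lambda>(v, col) c. card {u. (v, u) \<in> parcs G \<and> col u = c})"

definition decide :: "algorithm \<Rightarrow> 'v pair_pre_digraph \<Rightarrow> 'v config \<Rightarrow> decision" where
  "decide move G s = move (snd s (fst s)) (neighbor_colors G s)"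

(* After Stop the configuration is repeated forever, so that terminating and non-terminating
   runs alike are infinite sequences. *)
definition exploration_step ::
    "algorithm \<Rightarrow> 'v pair_pre_digraph \<Rightarrow> 'v config \<Rightarrow> 'v config \<Rightarrow> bool" where
  "exploration_step move G s s' \<longleftrightarrow>
     (case decide move G s of
        Stop \<Rightarrow> s' = s
      | Go c d \<Rightarrow> (\<exists>u. (fst s, u) \<in> parcs G \<and> snd s u = d \<and> s' = (u, (snd s)(fst s := c))))"

(* The adversary is the choice of v0 and of the neighbors u above; ranging over all adversaries
   is ranging over all v0 and all runs r from v0. *)
definition exploration_run ::
    "algorithm \<Rightarrow> 'v pair_pre_digraph \<Rightarrow> 'v \<Rightarrow> (nat \<Rightarrow> 'v config) \<Rightarrow> bool" where
  "exploration_run move G v0 r \<longleftrightarrow>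
     v0 \<in> pverts G \<and> r 0 = (v0, \<lambda>_. 0) \<and> (\<forall>i. exploration_step move G (r i) (r (Suc i)))"

definition successfully_explores :: "algorithm \<Rightarrow> 'v pair_pre_digraph \<Rightarrow> bool" where
  "successfully_explores move G \<longleftrightarrow>
     (\<forall>v0 r. exploration_run move G v0 r \<longrightarrow>
        (\<exists>t. (\<forall>v \<in> pverts G. \<exists>i\<le>t. fst (r i) = v) \<and> fst (r t) = v0 \<and> decide move G (r t) = Stop))"

definition assigned_colors ::
    "algorithm \<Rightarrow> 'v pair_pre_digraph \<Rightarrow> (nat \<Rightarrow> 'v config) \<Rightarrow> nat set" where
  "assigned_colors move G r = {c. c \<noteq> 0 \<and> (\<exists>i d. decide move G (r i) = Go c d)}"

(* On a finite graph assigned_colors is finite for every algorithm, as an assigned nonzero color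
   remains on its vertex; so card is the true number of colors. *)
definition uses_at_least_colors ::
    "algorithm \<Rightarrow> 'v pair_pre_digraph \<Rightarrow> nat \<Rightarrow> bool" where
  "uses_at_least_colors move G m \<longleftrightarrow>
     (\<exists>v0 r. exploration_run move G v0 r \<and> m \<le> card (assigned_colors move G r))"

end

theory Submission
  imports Defs
begin

text \<open>
  Let \<open>m = n - 3\<close>. The agent is placed in a clique \<open>C\<close> of \<open>m\<close> vertices, each of which has exactly
  one neighbor among the three remaining vertices \<open>W\<close>. As long as possible the adversary keeps the
  agent in \<open>C\<close>; meanwhile the environments do not depend on who is attached to whom, so the graph can
  be chosen afterwards. Since \<open>W\<close> must be visited, the agent is eventually at some \<open>v\<close> in \<open>C\<close>, every
  other vertex of \<open>C\<close> is colored, and the agent assigns \<open>c\<close> to \<open>v\<close> and asks for an uncolored neighbor.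

  If now two vertices \<open>i\<close>, \<open>j\<close> of \<open>C\<close> share a color \<open>a\<close>, hang one pendant vertex at \<open>i\<close>, one at \<open>j\<close>, and
  attach the rest of \<open>C\<close> to the third vertex of \<open>W\<close>. Both pendants receive the same color, so \<open>i\<close> and \<open>j\<close>
  end up with equal environments. Suppose the pendant at \<open>i\<close> is visited first. If the agent at \<open>i\<close> then
  moves to color \<open>a\<close>, it will commute between \<open>i\<close> and \<open>j\<close> forever once the other pendant is visited;
  if not, the adversary answers every request for \<open>a\<close> with \<open>i\<close>, and \<open>j\<close> with its pendant is never
  reached. (For \<open>m = 2\<close> there is no rest of \<open>C\<close>, and another graph is needed.)

  If \<open>C\<close> carries \<open>m\<close> distinct colors we are done. The remaining possibility is \<open>c = 0\<close>: the agent leaves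
  \<open>v\<close> uncolored. Then attach \<open>v\<close> to \<open>y\<close>, the rest of \<open>C\<close> to \<open>g\<close>, and \<open>y\<close> to \<open>g\<close> and to a pendant \<open>t\<close>. The
  agent moves to \<open>y\<close> and must color it. Either this is an \<open>m\<close>-th color, or it is the color of some \<open>w\<close>
  in \<open>C\<close> other than \<open>v\<close>. As \<open>w\<close> is adjacent to both \<open>v\<close> and \<open>g\<close>, the adversary can prevent any return
  to \<open>y\<close>, and \<open>t\<close> is never visited.
\<close>

subsection \<open>Runs and adversaries\<close>

text \<open>
  An adversary strategy is given by the configurations it visits: \<open>A\<close> before and \<open>B\<close> after \<open>u\<close> is
  visited.
\<close>

lemma escape:
  assumes explores: "successfully_explores move G" and v0: "v0 \<in> pverts G" and u: "u \<in> pverts G"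
    and prefix: "(\<lambda>s s'. exploration_step move G s s' \<and> fst s \<noteq> u)\<^sup>*\<^sup>* (v0, \<lambda>_. 0) s0"
    and start: "s0 \<in> A \<union> B"
    and avoid: "\<And>s. s \<in> A \<Longrightarrow> fst s \<noteq> u"
    and stepA: "\<And>s. s \<in> A \<Longrightarrow> \<exists>s' \<in> A \<union> B. exploration_step move G s s'"
    and no_stop: "\<And>s. s \<in> B \<Longrightarrow> fst s = v0 \<Longrightarrow> decide move G s \<noteq> Stop"
    and stepB: "\<And>s. s \<in> B \<Longrightarrow> \<exists>s' \<in> B. exploration_step move G s s'"
  shows False
proof -
  define R where "R = (\<lambda>s s'. exploration_step move G s s' \<and> fst s \<noteq> u)"
  \<comment> \<open>\<open>S\<close> adds the configurations that can still reach \<open>s0\<close>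
    without leaving \<open>u\<close>, so that one choice function generates the whole run. The run
    need not actually get to \<open>s0\<close>: if it lingers in the prefix part, \<open>u\<close>
    is simply never visited.\<close>
  define S where "S = A \<union> B \<union> {s. R\<^sup>*\<^sup>* s s0}"
  have prefix_cases: "s = s0 \<or> (\<exists>z. R s z \<and> R\<^sup>*\<^sup>* z s0)" if "R\<^sup>*\<^sup>* s s0" for s
    using that by (metis converse_rtranclpE)
  have ex: "\<exists>s'. exploration_step move G s s' \<and> s' \<in> S \<and> (s \<in> B \<longrightarrow> s' \<in> B)" if "s \<in> S" for s
  proof (cases "s \<in> A \<union> B")
    case True
    then show ?thesis using stepA[of s] stepB[of s] unfolding S_def by blast
  next
    case False
    then have "R\<^sup>*\<^sup>* s s0" using that unfolding S_def by blast
    with False start prefix_cases[of s] obtain z where "R s z" "R\<^sup>*\<^sup>* z s0" by blast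
    then show ?thesis using False unfolding S_def R_def by blast
  qed
  define nxt where
    "nxt s = (SOME s'. exploration_step move G s s' \<and> s' \<in> S \<and> (s \<in> B \<longrightarrow> s' \<in> B))" for s
  have nxt: "exploration_step move G s (nxt s) \<and> nxt s \<in> S \<and> (s \<in> B \<longrightarrow> nxt s \<in> B)" if "s \<in> S" for s
    unfolding nxt_def using ex[OF that] by (rule someI_ex)
  define r where "r i = (nxt ^^ i) (v0, \<lambda>_. 0)" for i
  have r_Suc: "r (Suc i) = nxt (r i)" for i by (simp add: r_def)
  have rS: "r i \<in> S" for i
  proof (induction i)
    case 0
    then show ?case using prefix by (simp add: r_def S_def R_def)
  next
    case (Suc i)
    then show ?case using nxt by (simp add: r_Suc)
  qed
  have "exploration_run move G v0 r"
    unfolding exploration_run_def using v0 rS nxt by (simp add: r_Suc) (simp add: r_def)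
  then obtain t where t: "\<forall>v \<in> pverts G. \<exists>i\<le>t. fst (r i) = v" "fst (r t) = v0"
      "decide move G (r t) = Stop"
    using explores unfolding successfully_explores_def by blast
  then obtain i where i: "i \<le> t" "fst (r i) = u" using u by blast
  \<comment> \<open>Members of \<open>A\<close> and proper prefix configurations are not at
    \<open>u\<close>. From here on the run cannot leave \<open>B\<close>, where it never stops at
    \<open>v0\<close>.\<close>
  have "r i \<in> B"
    using rS[of i] i(2) start avoid prefix_cases[of "r i"] unfolding S_def R_def by blast
  then have "r (i + k) \<in> B" for k
    by (induction k) (use rS nxt in \<open>auto simp: r_Suc\<close>)
  from this[of "t - i"] have "r t \<in> B" using i(1) by simp
  then show False using no_stop t(2,3) by blast
qed

lemma neighbor_colors_pos:
  assumes "neighbor_colors G (v, col) d > 0"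
  shows "\<exists>u. (v, u) \<in> parcs G \<and> col u = d"
  using assms by (force simp: neighbor_colors_def card_gt_0_iff)

lemma finite_neighbor_colors:
  assumes "finite (parcs G)"
  shows "finite {c. neighbor_colors G s c \<noteq> 0}"
proof -
  obtain v col where s: "s = (v, col)" by (cases s)
  have "{c. neighbor_colors G s c \<noteq> 0} \<subseteq> (\<lambda>e. col (snd e)) ` parcs G"
  proof
    fix c assume "c \<in> {c. neighbor_colors G s c \<noteq> 0}"
    then obtain u where "(v, u) \<in> parcs G" "col u = c"
      using neighbor_colors_pos[of G v col c] s by auto
    then show "c \<in> (\<lambda>e. col (snd e)) ` parcs G" by force
  qed
  then show ?thesis using assms finite_surj by blast
qed

lemma decide_GoD:
  assumes "exploration_algorithm move" "finite (parcs G)" "decide move G s = Go c d"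
  shows "neighbor_colors G s d > 0" "snd s (fst s) \<noteq> 0 \<Longrightarrow> c = snd s (fst s)"
  using assms finite_neighbor_colors[OF assms(2), of s]
  unfolding exploration_algorithm_def decide_def by blast+

lemma exploration_step_total:
  assumes "exploration_algorithm move" "finite (parcs G)"
  shows "\<exists>s'. exploration_step move G s s'"
proof (cases "decide move G s")
  case (Go c d)
  then show ?thesis
    using decide_GoD(1)[OF assms Go] neighbor_colors_pos[of G "fst s" "snd s" d]
    by (auto simp: exploration_step_def)
qed (auto simp: exploration_step_def)

lemma exploration_step_keeps:
  assumes "exploration_algorithm move" "finite (parcs G)" "exploration_step move G s s'" "snd s x \<noteq> 0"
  shows "snd s' x = snd s x"
  using assms decide_GoD(2)[OF assms(1,2)]
  by (cases "decide move G s") (auto simp: exploration_step_def)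

section \<open>Persistence of colors along runs, and counting the colors used\<close>

lemma run_keeps:
  assumes alg: "exploration_algorithm move" "finite (parcs G)" and run: "exploration_run move G v0 r"
    and "snd (r i) x \<noteq> 0" "i \<le> j"
  shows "snd (r j) x = snd (r i) x"
  using assms(5,4)
proof (induction rule: dec_induct)
  case (step j)
  then show ?case
    using exploration_step_keeps[OF alg, of "r j" "r (Suc j)" x] run
    by (auto simp: exploration_run_def)
qed simp

text \<open>A nonzero color never leaves its vertex, so each vertex accounts for at most one
  assigned color. Finiteness keeps \<open>card\<close> from being 0 by convention when it is bounded
  from below.\<close>

lemma finite_assigned_colors:
  assumes alg: "exploration_algorithm move" and G: "pair_graph G" and run: "exploration_run move G v0 r"
  shows "finite (assigned_colors move G r)"
proof -
  interpret pair_graph G by (rule G)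
  have step: "exploration_step move G (r i) (r (Suc i))" for i
    using run by (auto simp: exploration_run_def)
  have pos: "fst (r i) \<in> pverts G" for i
  proof (induction i)
    case 0
    then show ?case using run by (auto simp: exploration_run_def)
  next
    case (Suc i)
    then show ?case using step[of i]
      by (cases "decide move G (r i)") (auto simp: exploration_step_def dest: in_arcsD2)
  qed
  define f where "f v = (THE c. c \<noteq> 0 \<and> (\<exists>i. snd (r i) v = c))" for v
  have f: "f v = snd (r i) v" if "snd (r i) v \<noteq> 0" for v i
    unfolding f_def
  proof (rule the_equality)
    fix c assume "c \<noteq> 0 \<and> (\<exists>i. snd (r i) v = c)"
    then obtain j where j: "snd (r j) v = c" "c \<noteq> 0" by blast
    show "c = snd (r i) v"
      using run_keeps[OF alg pair_finite_arcs run, of _ v] j that by (metis nle_le)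
  qed (use that in auto)
  have "assigned_colors move G r \<subseteq> f ` pverts G"
  proof
    fix c assume "c \<in> assigned_colors move G r"
    then obtain i d where i: "c \<noteq> 0" "decide move G (r i) = Go c d"
      by (auto simp: assigned_colors_def)
    then have "snd (r (Suc i)) (fst (r i)) = c"
      using step[of i] by (auto simp: exploration_step_def)
    then have "f (fst (r i)) = c" using f[of "Suc i"] i by auto
    then show "c \<in> f ` pverts G" using pos by blast
  qed
  then show ?thesis using pair_finite_verts finite_surj by blast
qed

lemma ex_run_through:
  assumes alg: "exploration_algorithm move" and fin: "finite (parcs G)" and v0: "v0 \<in> pverts G"
    and reach: "(exploration_step move G)\<^sup>*\<^sup>* (v0, \<lambda>_. 0) s"
  shows "\<exists>r k. exploration_run move G v0 r \<and> r k = s"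
proof -
  define nxt where "nxt s = (SOME s'. exploration_step move G s s')" for s
  have nxt: "exploration_step move G s (nxt s)" for s
    unfolding nxt_def using exploration_step_total[OF alg fin] by (rule someI_ex)
  obtain k where "(exploration_step move G ^^ k) (v0, \<lambda>_. 0) s"
    using reach by (auto simp: rtranclp_power)
  then obtain f where f: "f 0 = (v0, \<lambda>_. 0)" "f k = s"
      "\<forall>i<k. exploration_step move G (f i) (f (Suc i))"
    by (auto simp: relpowp_fun_conv)
  define r where "r i = (if i \<le> k then f i else (nxt ^^ (i - k)) s)" for i
  have "exploration_step move G (r i) (r (Suc i))" for i
  proof -
    consider "i < k" | "i = k" | "i > k" by linarith
    then show ?thesis
      by cases (use f nxt in \<open>auto simp: r_def Suc_diff_le\<close>)
  qed
  then have "exploration_run move G v0 r" "r k = s"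
    using f v0 by (auto simp: exploration_run_def r_def)
  then show ?thesis by blast
qed

text \<open>All vertices start with color 0, so every nonzero color present in \<open>s\<close> was
  assigned on the way. The color \<open>c\<close> about to be assigned counts as well, since it may
  be the decisive one.\<close>

lemma uses_colors_of_reachable:
  assumes alg: "exploration_algorithm move" and G: "pair_graph G" and v0: "v0 \<in> pverts G"
    and reach: "(exploration_step move G)\<^sup>*\<^sup>* (v0, \<lambda>_. 0) s"
    and go: "decide move G s = Go c d"
    and K: "K \<subseteq> insert c (range (snd s)) - {0}"
  shows "uses_at_least_colors move G (card K)"
proof -
  interpret pair_graph G by (rule G)
  obtain r k where run: "exploration_run move G v0 r" and k: "r k = s"
    using ex_run_through[OF alg pair_finite_arcs v0 reach] by blast
  have assigned: "x \<in> assigned_colors move G r" if "x \<in> range (snd (r i))" "x \<noteq> 0" for x i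
    using that(1)
  proof (induction i)
    case 0
    then show ?case using run that(2) by (auto simp: exploration_run_def)
  next
    case (Suc i)
    have "exploration_step move G (r i) (r (Suc i))" using run by (auto simp: exploration_run_def)
    then have "x \<in> range (snd (r i)) \<or> (\<exists>d. decide move G (r i) = Go x d)"
      using Suc.prems by (cases "decide move G (r i)") (auto simp: exploration_step_def split: if_splits)
    then show ?case using Suc.IH that(2) by (auto simp: assigned_colors_def)
  qed
  have "K \<subseteq> assigned_colors move G r"
  proof
    fix x assume "x \<in> K"
    then have "x \<noteq> 0" and x: "x = c \<or> x \<in> range (snd (r k))" using K k by auto
    from x show "x \<in> assigned_colors move G r"
    proof
      assume "x = c"
      then show ?thesis using \<open>x \<noteq> 0\<close> go k by (auto simp: assigned_colors_def)
    qed (use assigned \<open>x \<noteq> 0\<close> in blast)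
  qed
  then have "card K \<le> card (assigned_colors move G r)"
    using finite_assigned_colors[OF alg G run] card_mono by blast
  then show ?thesis using run unfolding uses_at_least_colors_def by blast
qed

subsection \<open>Graphs containing a clique\<close>

definition graph_on :: "nat \<Rightarrow> (nat \<Rightarrow> nat \<Rightarrow> bool) \<Rightarrow> nat pair_pre_digraph" where
  "graph_on n E = \<lparr>pverts = {..<n}, parcs = {(u, v). u < n \<and> v < n \<and> u \<noteq> v \<and> (E u v \<or> E v u)}\<rparr>"

lemma pverts_graph_on [simp]: "pverts (graph_on n E) = {..<n}"
  by (simp add: graph_on_def)

lemma parcs_graph_on:
  "(u, v) \<in> parcs (graph_on n E) \<longleftrightarrow> u < n \<and> v < n \<and> u \<noteq> v \<and> (E u v \<or> E v u)"
  by (simp add: graph_on_def)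

lemma pair_graph_graph_on: "pair_graph (graph_on n E)"
proof
  have "parcs (graph_on n E) \<subseteq> {..<n} \<times> {..<n}" by (auto simp: graph_on_def)
  then show "finite (parcs (graph_on n E))" by (rule finite_subset) simp
qed (auto simp: graph_on_def symmetric_def sym_def)

lemma connected_graph_on:
  assumes "r < n" "\<And>v. v < n \<Longrightarrow> (v, r) \<in> (parcs (graph_on n E))\<^sup>*"
  shows "connected_graph (graph_on n E)"
proof -
  let ?G = "graph_on n E"
  interpret pair_graph ?G by (rule pair_graph_graph_on)
  have sym: "sym ((parcs ?G)\<^sup>*)"
    using pair_sym_arcs by (intro sym_rtrancl) (auto simp: symmetric_def)
  have "(u, v) \<in> (parcs ?G)\<^sup>*" if "u < n" "v < n" for u v
    using assms(2)[OF that(1)] symD[OF sym assms(2)[OF that(2)]] by (rule rtrancl_trans)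
  then have "(u, v) \<in> ((parcs ?G)\<^sup>s)\<^sup>*" if "u < n" "v < n" for u v
    using that rtrancl_mono[of "parcs ?G" "(parcs ?G)\<^sup>s"] by (auto simp: symcl_def)
  then have "connected (with_proj ?G)"
    using assms(1)
    by (auto simp: connected_conv symcl_def parcs_graph_on intro!: rtrancl_consistent_rtrancl_on)
  then show ?thesis
    unfolding connected_graph_def using pair_graph_graph_on by blast
qed

text \<open>
  The environment of \<open>v\<close> in the clique \<open>{..<m}\<close> when its only neighbor outside the clique has color \<open>e\<close>.
\<close>

definition clique_env :: "nat \<Rightarrow> (nat \<Rightarrow> nat) \<Rightarrow> nat \<Rightarrow> nat \<Rightarrow> nat \<Rightarrow> nat" where
  "clique_env m col v e = (\<lambda>c. card {u. u < m \<and> u \<noteq> v \<and> col u = c} + (if c = e then 1 else 0))"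

lemma clique_env_cong:
  assumes "\<And>u. u < m \<Longrightarrow> col u = col' u"
  shows "clique_env m col v e = clique_env m col' v e"
proof -
  have "{u. u < m \<and> u \<noteq> v \<and> col u = c} = {u. u < m \<and> u \<noteq> v \<and> col' u = c}" for c
    using assms by auto
  then show ?thesis by (simp add: clique_env_def)
qed

text \<open>Leaving out \<open>v\<close> lowers the count of the class of \<open>col v\<close> by
  one, and \<open>i\<close> and \<open>j\<close> lie in the same class. Equally colored clique
  vertices thus look alike whenever their outer neighbors have equal colors.\<close>

lemma clique_env_same_color:
  assumes "i < m" "j < m" "col i = col j"
  shows "clique_env m col i e = clique_env m col j e"
proof -
  have "{u. u < m \<and> u \<noteq> v \<and> col u = c} = {u. u < m \<and> col u = c} - {v}" for v c
    by auto
  then have "card {u. u < m \<and> u \<noteq> v \<and> col u = c}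
      = card {u. u < m \<and> col u = c} - (if col v = c then 1 else 0)" if "v < m" for v c
    using that by (simp add: card_Diff_singleton_if)
  then show ?thesis using assms by (simp add: clique_env_def)
qed

text \<open>Arcs among the three outer vertices are left open, because the cases of the proof
  connect them differently.\<close>

locale clique_graph =
  fixes move :: algorithm and m :: nat and G :: "nat pair_pre_digraph" and h :: "nat \<Rightarrow> nat"
  assumes alg: "exploration_algorithm move"
    and graph: "pair_graph G"
    and verts: "pverts G = {..<m + 3}"
    and m_pos: "m > 0"
    and outer: "\<And>v. v < m \<Longrightarrow> m \<le> h v \<and> h v < m + 3"
    and nbr: "\<And>v u. v < m \<Longrightarrow> (v, u) \<in> parcs G \<longleftrightarrow> u < m \<and> u \<noteq> v \<or> u = h v"
    and explores: "successfully_explores move G"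
begin

sublocale pair_graph G by (rule graph)

abbreviation "step \<equiv> exploration_step move G"
abbreviation "start \<equiv> (0, \<lambda>_. 0) :: nat config"

lemma arc_sym: "(u, v) \<in> parcs G \<Longrightarrow> (v, u) \<in> parcs G"
  using pair_sym_arcs by (auto simp: symmetric_def dest: symD)

lemma arc_bound: "(u, v) \<in> parcs G \<Longrightarrow> v < m + 3"
  using in_arcsD2 verts by blast

lemma start_vert: "0 \<in> pverts G"
  by (simp add: verts)

lemma decide_clique:
  assumes "v < m"
  shows "decide move G (v, col) = move (col v) (clique_env m col v (col (h v)))"
proof -
  have "neighbor_colors G (v, col) c = clique_env m col v (col (h v)) c" for c
  proof -
    have "{u. (v, u) \<in> parcs G \<and> col u = c}
        = {u. u < m \<and> u \<noteq> v \<and> col u = c} \<union> {u. u = h v \<and> col u = c}"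
      using assms by (auto simp: nbr)
    moreover have "\<not> h v < m" using outer[OF assms] by auto
    moreover have "{u. u = h v \<and> col u = c} = (if c = col (h v) then {h v} else {})" by auto
    ultimately show ?thesis
      by (simp add: neighbor_colors_def clique_env_def card_insert_if)
  qed
  then have "neighbor_colors G (v, col) = clique_env m col v (col (h v))" by blast
  then show ?thesis by (simp add: decide_def)
qed

lemma decide_pendant:
  assumes "\<And>u. (w, u) \<in> parcs G \<longleftrightarrow> u = x"
  shows "decide move G (w, col) = move (col w) (\<lambda>c. if c = col x then 1 else 0)"
proof -
  have "{u. (w, u) \<in> parcs G \<and> col u = c} = (if c = col x then {x} else {})" for c
    using assms by auto
  then have "neighbor_colors G (w, col) = (\<lambda>c. if c = col x then 1 else 0)"
    by (auto simp: neighbor_colors_def fun_eq_iff)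
  then show ?thesis by (simp add: decide_def)
qed

lemma GoE:
  assumes "decide move G (p, col) = Go c d"
  obtains u where "(p, u) \<in> parcs G" "col u = d" "col p \<noteq> 0 \<Longrightarrow> c = col p"
  using decide_GoD[OF alg pair_finite_arcs assms] neighbor_colors_pos[of G p col d] by auto

lemma stepI:
  assumes "decide move G (p, col) = Go c d" "(p, u) \<in> parcs G" "col u = d"
  shows "step (p, col) (u, col(p := c))"
  using assms by (auto simp: exploration_step_def)

lemma step_Stop: "decide move G s = Stop \<Longrightarrow> step s s"
  by (auto simp: exploration_step_def)

lemmas step_keeps = exploration_step_keeps[OF alg pair_finite_arcs]

lemmas escape' = escape[OF explores start_vert]

end

text \<open>No graph occurs here: while all outer vertices are uncolored, environments in the clique
  do not depend on the attachments. A sequence of such steps can therefore be replayed in a graph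
  chosen afterwards.\<close>

definition clique_step :: "algorithm \<Rightarrow> nat \<Rightarrow> nat config \<Rightarrow> nat config \<Rightarrow> bool" where
  "clique_step move m s s' \<longleftrightarrow>
     (\<exists>v col c u. s = (v, col) \<and> v < m \<and> (\<forall>w\<ge>m. col w = 0) \<and> u < m \<and> u \<noteq> v \<and>
        move (col v) (clique_env m col v 0) = Go c (col u) \<and> s' = (u, col(v := c)))"

context clique_graph
begin

lemma clique_steps_inv:
  assumes "(clique_step move m)\<^sup>*\<^sup>* start (v, col)"
  shows "v < m" "\<And>w. w \<ge> m \<Longrightarrow> col w = 0"
proof -
  have "fst s < m \<and> (\<forall>w\<ge>m. snd s w = 0)" if "(clique_step move m)\<^sup>*\<^sup>* start s" for s
    using that by induction (use m_pos in \<open>auto simp: clique_step_def\<close>)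
  from this[OF assms] show "v < m" "\<And>w. w \<ge> m \<Longrightarrow> col w = 0" by auto
qed

lemma clique_step_imp_step:
  assumes "clique_step move m s s'"
  shows "step s s' \<and> fst s < m"
proof -
  obtain v col c u where s: "s = (v, col)" "s' = (u, col(v := c))" "v < m" "u < m" "u \<noteq> v"
      "\<forall>w\<ge>m. col w = 0" "move (col v) (clique_env m col v 0) = Go c (col u)"
    using assms by (auto simp: clique_step_def)
  moreover from this have "decide move G (v, col) = Go c (col u)"
    using outer by (simp add: decide_clique)
  ultimately show ?thesis using stepI nbr by auto
qed

text \<open>The relation \<open>R\<close> lets a replayed phase also record that the agent avoided
  certain outer vertices.\<close>

lemma clique_steps_imp_steps:
  assumes "(clique_step move m)\<^sup>*\<^sup>* s s'" "\<And>s s'. step s s' \<and> fst s < m \<Longrightarrow> R s s'"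
  shows "R\<^sup>*\<^sup>* s s'"
  using assms(1) by (rule rtranclp_mono[THEN predicate2D, rotated])
    (use clique_step_imp_step assms(2) in blast)

text \<open>Otherwise the adversary answers every request inside the clique, or the agent stops
  there, and the outer vertex \<open>m\<close> is never visited.\<close>

lemma clique_phase_ends:
  obtains v col c where "(clique_step move m)\<^sup>*\<^sup>* start (v, col)"
    "move (col v) (clique_env m col v 0) = Go c 0" "\<And>u. u < m \<Longrightarrow> u \<noteq> v \<Longrightarrow> col u \<noteq> 0"
proof (rule ccontr)
  note found = that
  assume neg: "\<not> thesis"
  define A where "A = {s. (clique_step move m)\<^sup>*\<^sup>* start s}"
  have "\<exists>s' \<in> A \<union> {}. step s s'" if "s \<in> A" for s
  proof -
    obtain v col where s: "s = (v, col)" by (cases s)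
    have reach: "(clique_step move m)\<^sup>*\<^sup>* start (v, col)" using that by (simp add: A_def s)
    note inv = clique_steps_inv[OF reach]
    have decide: "decide move G s = move (col v) (clique_env m col v 0)"
      using inv outer by (simp add: s decide_clique)
    show ?thesis
    proof (cases "decide move G s")
      case Stop
      then show ?thesis using that step_Stop by blast
    next
      case (Go c d)
      show ?thesis
      proof (cases "\<exists>u<m. u \<noteq> v \<and> col u = d")
        case True
        then obtain u where u: "u < m" "u \<noteq> v" "col u = d" by blast
        then have "clique_step move m s (u, col(v := c))"
          unfolding clique_step_def using Go decide s inv by metis
        then show ?thesis
          using that clique_step_imp_step unfolding A_def
          by (metis Un_iff mem_Collect_eq rtranclp.rtrancl_into_rtrancl)
      next
        case False
        obtain u where "(v, u) \<in> parcs G" "col u = d" using Go s GoE by blast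
        \<comment> \<open>The only candidate left is \<open>h v\<close>, which is uncolored; hence
          no other clique vertex is uncolored.\<close>
        with False have "d = 0" using nbr inv outer by metis
        then show ?thesis using False neg found[OF reach, of c] Go decide by auto
      qed
    qed
  qed
  moreover have "(\<lambda>s s'. step s s' \<and> fst s \<noteq> m)\<^sup>*\<^sup>* start start" by blast
  moreover have "fst s \<noteq> m" if "s \<in> A" for s
    using that clique_steps_inv(1) unfolding A_def by (cases s) force
  ultimately show False
    using escape'[of m start A "{}"] verts by (auto simp: A_def)
qed

end

subsection \<open>Two clique vertices of equal color\<close>

locale trap = clique_graph +
  fixes i j wi wj w1 :: nat
  assumes i: "i < m" and j: "j < m" and ij: "i \<noteq> j"
    and wi: "h i = wi" and wj: "h j = wj" and other: "\<And>v. v < m \<Longrightarrow> v \<noteq> i \<Longrightarrow> v \<noteq> j \<Longrightarrow> h v = w1"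
    and w: "wi \<noteq> wj" "w1 \<noteq> wi" "w1 \<noteq> wj" "{m..<m + 3} = {wi, wj, w1}"
    and nbr_wi: "\<And>u. (wi, u) \<in> parcs G \<longleftrightarrow> u = i"
    and nbr_wj: "\<And>u. (wj, u) \<in> parcs G \<longleftrightarrow> u = j"
begin

lemma w_ge: "wi \<ge> m" "wj \<ge> m" "wi < m + 3" "wj < m + 3"
  using outer i j wi wj by auto

lemma vertex_cases: "p < m + 3 \<Longrightarrow> p < m \<or> p = wi \<or> p = wj \<or> p = w1"
  using w(4) by (metis atLeastLessThan_iff insertE leI singletonD)

lemma arc_wi: "(p, wi) \<in> parcs G \<longleftrightarrow> p = i"
  using nbr_wi arc_sym by blast

lemma arc_wj: "(p, wj) \<in> parcs G \<longleftrightarrow> p = j"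
  using nbr_wj arc_sym by blast

lemma arc_j: "(p, j) \<in> parcs G \<longleftrightarrow> p < m \<and> p \<noteq> j \<or> p = wj"
  using nbr[OF j] arc_sym wj by blast

lemma no_first_pendant:
  assumes prefix: "(\<lambda>s s'. step s s' \<and> fst s \<noteq> wj)\<^sup>*\<^sup>* start (wi, col)"
    and colored: "\<And>u. u < m \<Longrightarrow> col u \<noteq> 0" and dup: "col i = col j"
    and fresh: "col wi = 0" "col wj = 0"
  shows False
proof -
  define a where "a = col i"
  \<comment> \<open>The color that a pendant receives when its neighbor has color \<open>a\<close>.
    On \<open>Stop\<close> the run rests at the pendant, so the value 0 is arbitrary.\<close>
  define b where "b = (case move 0 (\<lambda>c. if c = a then 1 else 0) of Stop \<Rightarrow> 0 | Go b d \<Rightarrow> b)"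
  define env where "env = clique_env m col i b"
  have a: "a \<noteq> 0" "col i = a" "col j = a"
    using colored[OF i] dup by (auto simp: a_def)
  have decide_ij: "decide move G (k, c') = move a env"
    if "k = i \<or> k = j" "\<And>u. u < m \<Longrightarrow> c' u = col u" "c' (h k) = b" for k c'
  proof -
    have k: "k < m" using that(1) i j by auto
    have "clique_env m c' k b = clique_env m col k b" using that(2) by (rule clique_env_cong)
    also have "\<dots> = env" unfolding env_def
      using that(1) clique_env_same_color[OF i j dup] by auto
    finally show ?thesis using that k a by (auto simp: decide_clique)
  qed
  have pendant_i: "c = b" if "decide move G (wi, c') = Go c d" "\<And>u. u < m \<Longrightarrow> c' u = col u"
      "c' wi = 0 \<or> c' wi = b" for c' c d
  proof (cases "c' wi = 0")
    case True
    then show ?thesis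
      using that(1) that(2)[OF i] a by (simp add: decide_pendant[OF nbr_wi] b_def)
  next
    case False
    then show ?thesis using GoE[OF that(1)] that(3) by metis
  qed
  have keep: "c = col p" if "decide move G (p, c') = Go c d" "p < m" "\<And>u. u < m \<Longrightarrow> c' u = col u"
    for c' c d p
    using GoE[OF that(1)] that(2,3) colored by metis
  text \<open>
    Configurations before the second pendant is visited. The color \<open>b\<close> may be 0, in which case the
    pendants stay uncolored and the argument is the same.
  \<close>
  define Good where "Good = {(p, c'). (\<forall>u<m. c' u = col u) \<and> c' wj = 0 \<and> p \<noteq> wj \<and> p < m + 3 \<and>
    (if p = wi then c' wi = 0 \<or> c' wi = b else c' wi = b)}"
  have Good_step: "(\<forall>u<m. (c'(p := c)) u = col u) \<and> (c'(p := c)) wj = 0 \<and> (c'(p := c)) wi = b"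
    if "(p, c') \<in> Good" "decide move G (p, c') = Go c d" for p c' c d
  proof -
    have *: "\<And>u. u < m \<Longrightarrow> c' u = col u" "c' wj = 0" "p \<noteq> wj"
      "if p = wi then c' wi = 0 \<or> c' wi = b else c' wi = b"
      using that(1) by (auto simp: Good_def)
    show ?thesis
      using * keep[OF that(2) _ *(1)] pendant_i[of c' c d] that(2) by (auto split: if_splits)
  qed
  have start_Good: "(wi, col) \<in> Good"
    using fresh w w_ge by (auto simp: Good_def)
  show False
  proof (cases "move a env = Go a a")
    case True
    \<comment> \<open>The second pendant is being visited, or both pendants are done and the agent
      commutes between \<open>i\<close> and \<open>j\<close>. Even if one of these is the start
      vertex 0, the decision there is \<open>Go a a\<close>.\<close>
    define B where "B = {(p, c'). (\<forall>u<m. c' u = col u) \<and> c' wi = b \<and>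
      (p = wj \<and> c' wj = 0 \<or> (p = i \<or> p = j) \<and> c' wj = b)}"
    have stepA: "\<exists>s' \<in> Good \<union> B. step s s'" if s: "s \<in> Good" for s
    proof (cases "decide move G s")
      case Stop
      then show ?thesis using s step_Stop by blast
    next
      case (Go c d)
      obtain p c' where pc: "s = (p, c')" by (cases s)
      obtain u where u: "(p, u) \<in> parcs G" "c' u = d" using Go pc GoE by blast
      have "(u, c'(p := c)) \<in> Good \<union> B"
        using Good_step[of p c' c d] s Go pc arc_bound[OF u(1)]
        by (cases "u = wj") (auto simp: Good_def B_def)
      then show ?thesis using stepI[of p c' c d u] Go pc u by blast
    qed
    have decideB: "decide move G (p, c') = Go a a" if "(p, c') \<in> B" "p \<noteq> wj" for p c'
      using that True wi wj by (subst decide_ij) (auto simp: B_def)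
    have stepB: "\<exists>s' \<in> B. step s s'" if s: "s \<in> B" for s
    proof -
      obtain p c' where pc: "s = (p, c')" by (cases s)
      show ?thesis
      proof (cases "p = wj")
        case True
        then have *: "\<And>u. u < m \<Longrightarrow> c' u = col u" "c' wi = b" "c' wj = 0"
          using s pc w_ge i j by (auto simp: B_def)
        have decide: "decide move G s = move 0 (\<lambda>c. if c = a then 1 else 0)"
          using pc True * j a by (simp add: decide_pendant[OF nbr_wj])
        show ?thesis
        proof (cases "decide move G s")
          case Stop
          then show ?thesis using s step_Stop by blast
        next
          case (Go c d)
          obtain u where u: "(p, u) \<in> parcs G" "c' u = d" using Go pc GoE by blast
          then have "u = j" using True nbr_wj by blast
          moreover have "c = b" using Go decide by (simp add: b_def)
          ultimately have "(u, c'(p := c)) \<in> B"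
            using * True w w_ge by (auto simp: B_def)
          then show ?thesis using stepI[of p c' c d u] Go pc u by blast
        qed
      next
        case False
        define q where "q = (if p = i then j else i)"
        have p: "p = i \<or> p = j" "\<forall>u<m. c' u = col u" using s pc False by (auto simp: B_def)
        then have "(p, q) \<in> parcs G" "c' q = a" "c' p = a"
          using i j ij a by (auto simp: q_def nbr)
        then have "step s (q, c'(p := a))"
          using stepI decideB[of p c'] s pc False by blast
        moreover have "(q, c'(p := a)) \<in> B"
          using s pc False p \<open>c' p = a\<close> by (auto simp: B_def q_def fun_upd_idem)
        ultimately show ?thesis by blast
      qed
    qed
    show False
    proof (rule escape'[OF _ prefix, of Good B])
      show "wj \<in> pverts G" using w_ge verts by auto
      show "(wi, col) \<in> Good \<union> B" using start_Good by blast
      show "fst s \<noteq> wj" if "s \<in> Good" for s using that by (auto simp: Good_def)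
      show "decide move G s \<noteq> Stop" if "s \<in> B" "fst s = 0" for s
        using that decideB[of 0 "snd s"] w_ge m_pos by (cases s) auto
    qed (use stepA stepB in blast)+
  next
    case False
    \<comment> \<open>Only \<open>j\<close> gives access to \<open>wj\<close>. At \<open>i\<close>
      color \<open>a\<close> is never requested, and all other clique vertices have \<open>i\<close>
      as an alternative to \<open>j\<close>.\<close>
    define A where "A = {s \<in> Good. fst s \<noteq> j}"
    have stepA: "\<exists>s' \<in> A \<union> {}. step s s'" if s: "s \<in> A" for s
    proof (cases "decide move G s")
      case Stop
      then show ?thesis using s step_Stop by blast
    next
      case (Go c d)
      obtain p c' where pc: "s = (p, c')" by (cases s)
      have *: "\<And>u. u < m \<Longrightarrow> c' u = col u" "c' wj = 0" "p \<noteq> wj" "p \<noteq> j" "p \<noteq> wi \<Longrightarrow> c' wi = b"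
        using s pc by (auto simp: Good_def A_def split: if_splits)
      obtain u where u: "(p, u) \<in> parcs G" "c' u = d" using Go pc GoE by blast
      have "\<exists>u. (p, u) \<in> parcs G \<and> c' u = d \<and> u \<noteq> j"
      proof (cases "u = j")
        case True
        then have p: "p < m" using u(1) arc_j * by blast
        have d: "d = a" using u True * j a by simp
        have "p \<noteq> i"
        proof
          assume "p = i"
          then have "decide move G s = move a env"
            using decide_ij[of i c'] * pc wi w_ge i by auto
          moreover have "c = a" using keep Go pc p * \<open>p = i\<close> a by metis
          ultimately show False using False Go d by simp
        qed
        then show ?thesis using p i ij d * a nbr by auto
      qed (use u in blast)
      then obtain u where u: "(p, u) \<in> parcs G" "c' u = d" "u \<noteq> j" by blast
      moreover have "u \<noteq> wj" using u(1) arc_wj * by blast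
      ultimately have "(u, c'(p := c)) \<in> A"
        using Good_step[of p c' c d] s Go pc arc_bound[OF u(1)]
        by (auto simp: Good_def A_def)
      then show ?thesis using stepI[of p c' c d u] Go pc u by blast
    qed
    show False
    proof (rule escape'[OF _ prefix, of A "{}"])
      show "wj \<in> pverts G" using w_ge verts by auto
      show "(wi, col) \<in> A \<union> {}" using start_Good w_ge j by (auto simp: A_def)
      show "fst s \<noteq> wj" if "s \<in> A" for s using that by (auto simp: Good_def A_def)
    qed (use stepA in blast)+
  qed
qed

end

text \<open>Exchanging the roles of \<open>i\<close> and \<open>j\<close> covers the case that the
  pendant at \<open>j\<close> is visited first.\<close>

sublocale trap \<subseteq> swap: trap move m G h j i wj wi w1
  using i j ij wi wj other w nbr_wi nbr_wj by unfold_locales auto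

context trap
begin

text \<open>Here other clique vertices may still be uncolored. The adversary avoids both pendants as
  long as it can; once it is forced into one, the whole clique is colored and
  \<open>no_first_pendant\<close> applies.\<close>

lemma no_duplicate_color:
  assumes prefix: "(\<lambda>s s'. step s s' \<and> fst s \<noteq> wi \<and> fst s \<noteq> wj)\<^sup>*\<^sup>* start (p0, col)"
    and p0: "p0 < m" and dup: "col i = col j" "col i \<noteq> 0" and fresh: "col wi = 0" "col wj = 0"
  shows False
proof -
  define R where "R = (\<lambda>s s'. step s s' \<and> fst s \<noteq> wi \<and> fst s \<noteq> wj)"
  \<comment> \<open>Reachability by \<open>R\<close> is part of \<open>A\<close> because it becomes
    the prefix for \<open>no_first_pendant\<close>.\<close>
  define A where "A = {(p, c'). R\<^sup>*\<^sup>* start (p, c') \<and> (p < m \<or> p = w1) \<and> c' wi = 0 \<and> c' wj = 0 \<and>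
    c' i = col i \<and> c' j = col i}"
  have R_avoid: "(\<lambda>s s'. step s s' \<and> fst s \<noteq> wi)\<^sup>*\<^sup>* s s'" "(\<lambda>s s'. step s s' \<and> fst s \<noteq> wj)\<^sup>*\<^sup>* s s'"
    if "R\<^sup>*\<^sup>* s s'" for s s'
    using that by (auto simp: R_def elim!: rtranclp_mono[THEN predicate2D, rotated])
  have stepA: "\<exists>s' \<in> A \<union> {}. step s s'" if s: "s \<in> A" for s
  proof (cases "decide move G s")
    case Stop
    then show ?thesis using s step_Stop by blast
  next
    case (Go c d)
    obtain p c' where pc: "s = (p, c')" by (cases s)
    have *: "R\<^sup>*\<^sup>* start (p, c')" "p < m \<or> p = w1" "c' wi = 0" "c' wj = 0" "c' i = col i" "c' j = col i"
      using s pc by (auto simp: A_def)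
    have p: "p \<noteq> wi" "p \<noteq> wj" using *(2) w w_ge by auto
    have R_step: "R\<^sup>*\<^sup>* start (u, c'(p := c))" if "(p, u) \<in> parcs G" "c' u = d" for u
      using *(1) stepI[of p c' c d u] that Go pc p unfolding R_def
      by (auto intro: rtranclp.rtrancl_into_rtrancl)
    show ?thesis
    proof (cases "\<exists>u. (p, u) \<in> parcs G \<and> c' u = d \<and> u \<noteq> wi \<and> u \<noteq> wj")
      case True
      then obtain u where u: "(p, u) \<in> parcs G" "c' u = d" "u \<noteq> wi" "u \<noteq> wj" by blast
      have step: "step s (u, c'(p := c))" using stepI Go pc u by blast
      have "(c'(p := c)) k = c' k" if "c' k \<noteq> 0" for k
        using step_keeps[OF step] that pc by auto
      then have "(u, c'(p := c)) \<in> A"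
        using R_step[OF u(1,2)] * u p vertex_cases[OF arc_bound[OF u(1)]] dup(2)
        by (auto simp: A_def)
      then show ?thesis using step by blast
    next
      \<comment> \<open>Only a pendant has the requested color, so this color is 0 and every other
        clique vertex is colored.\<close>
      case False
      obtain u where u: "(p, u) \<in> parcs G" "c' u = d" "c' p \<noteq> 0 \<Longrightarrow> c = c' p" using Go pc GoE by metis
      with False have u_w: "u = wi \<or> u = wj" by blast
      then have d: "d = 0" and pij: "u = wi \<and> p = i \<or> u = wj \<and> p = j"
        using u(1,2) * arc_wi arc_wj by auto
      have c: "c = col i" "c' p = col i" using u(3) pij * dup by auto
      have p_m: "p < m" using pij i j by auto
      have "c' v \<noteq> 0" if "v < m" "v \<noteq> p" for v
        using False d that p_m nbr[of p v] w_ge by auto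
      then have colored: "(c'(p := c)) v \<noteq> 0" if "v < m" for v using that c dup by auto
      have fresh: "(c'(p := c)) wi = 0" "(c'(p := c)) wj = 0" using * p by auto
      have same: "(c'(p := c)) i = (c'(p := c)) j" using * c by auto
      show ?thesis
        using u_w
      proof
        assume "u = wi"
        then show ?thesis
          using no_first_pendant[OF R_avoid(2)[OF R_step, unfolded \<open>u = wi\<close>] colored same fresh]
            u(1,2) by blast
      next
        assume "u = wj"
        then show ?thesis
          using swap.no_first_pendant[OF R_avoid(1)[OF R_step, unfolded \<open>u = wj\<close>] colored
              same[symmetric] fresh(2,1)] u(1,2) by blast
      qed
    qed
  qed
  have s0: "R\<^sup>*\<^sup>* start (p0, col)" using prefix by (simp add: R_def)
  show False
  proof (rule escape'[OF _ R_avoid(1)[OF s0], of A "{}"])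
    show "wi \<in> pverts G" using w_ge verts by auto
    show "(p0, col) \<in> A \<union> {}" using s0 p0 dup fresh by (auto simp: A_def)
    show "fst s \<noteq> wi" if "s \<in> A" for s using that w w_ge by (auto simp: A_def)
  qed (use stepA in blast)+
qed

end

subsection \<open>An uncolored clique vertex\<close>

definition clique_with :: "nat \<Rightarrow> (nat \<Rightarrow> nat) \<Rightarrow> (nat \<Rightarrow> nat \<Rightarrow> bool) \<Rightarrow> nat pair_pre_digraph" where
  "clique_with m h F = graph_on (m + 3) (\<lambda>u v. u < m \<and> (v < m \<or> v = h u) \<or> m \<le> u \<and> m \<le> v \<and> F u v)"

lemma parcs_clique_with:
  "(u, v) \<in> parcs (clique_with m h F) \<longleftrightarrow> u < m + 3 \<and> v < m + 3 \<and> u \<noteq> v \<and>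
     (u < m \<and> v < m \<or> u < m \<and> v = h u \<or> v < m \<and> u = h v \<or> m \<le> u \<and> m \<le> v \<and> (F u v \<or> F v u))"
  by (auto simp: clique_with_def parcs_graph_on)

lemma clique_graph_clique_with:
  assumes "exploration_algorithm move" "m > 0" "\<And>v. v < m \<Longrightarrow> m \<le> h v \<and> h v < m + 3"
    and "successfully_explores move (clique_with m h F)"
  shows "clique_graph move m (clique_with m h F) h"
proof (rule clique_graph.intro)
  show "pair_graph (clique_with m h F)" by (simp add: clique_with_def pair_graph_graph_on)
  show "pverts (clique_with m h F) = {..<m + 3}" by (simp add: clique_with_def)
  show "(v, u) \<in> parcs (clique_with m h F) \<longleftrightarrow> u < m \<and> u \<noteq> v \<or> u = h v" if "v < m" for v u
    using assms(3)[OF that] assms(3)[of u] that by (auto simp: parcs_clique_with)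
qed (use assms in auto)

lemma connected_clique_with:
  assumes "m > 0"
    and "\<And>w. m \<le> w \<Longrightarrow> w < m + 3 \<Longrightarrow> (\<exists>u<m. h u = w) \<or>
      (\<exists>u w'. u < m \<and> h u = w' \<and> m \<le> w' \<and> w' < m + 3 \<and> w \<noteq> w' \<and> (F w w' \<or> F w' w))"
  shows "connected_graph (clique_with m h F)" "card (pverts (clique_with m h F)) = m + 3"
proof -
  let ?A = "parcs (clique_with m h F)"
  have inner: "(v, 0) \<in> ?A\<^sup>*" if "v < m" for v
    using that assms(1) by (cases "v = 0") (auto intro!: r_into_rtrancl simp: parcs_clique_with)
  have "(w, 0) \<in> ?A\<^sup>*" if w: "w < m + 3" for w
  proof (cases "w < m")
    case False
    from assms(2)[of w] False w consider
        u where "u < m" "h u = w"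
      | u w' where "u < m" "h u = w'" "m \<le> w'" "w' < m + 3" "w \<noteq> w'" "F w w' \<or> F w' w"
      by force
    then show ?thesis
    proof cases
      case (1 u)
      then have "(w, u) \<in> ?A" using False w by (auto simp: parcs_clique_with)
      then show ?thesis using inner[OF 1(1)] by (rule converse_rtrancl_into_rtrancl)
    next
      case (2 u w')
      then have "(w, w') \<in> ?A" "(w', u) \<in> ?A" using False w by (auto simp: parcs_clique_with)
      then show ?thesis using inner[OF 2(1)] by (blast intro: converse_rtrancl_into_rtrancl)
    qed
  qed (use inner in blast)
  then show "connected_graph (clique_with m h F)"
    unfolding clique_with_def using assms(1) by (intro connected_graph_on[of 0]) auto
qed (simp add: clique_with_def)

section \<open>Adversaries that rely on fewer than \<open>m\<close> colors being used\<close>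

locale few_colors = clique_graph +
  assumes few: "\<not> uses_at_least_colors move G m"
begin

lemma card_colors_less:
  assumes "step\<^sup>*\<^sup>* start (p, col)" "decide move G (p, col) = Go c d" "K \<subseteq> insert c (range col) - {0}"
  shows "card K \<noteq> m"
  using uses_colors_of_reachable[OF alg graph start_vert assms(1,2), of K] assms(3) few by auto

text \<open>The vertices \<open>m\<close>, \<open>m + 1\<close>, \<open>m + 2\<close> are
  \<open>y\<close>, \<open>g\<close>, \<open>t\<close> of the overview and \<open>x\<close> is the
  uncolored clique vertex. The cases are: the agent leaves \<open>y\<close> uncolored, repeats a
  clique color, or uses a new one.\<close>

lemma no_skip:
  assumes x: "x < m"
    and hx: "h x = m" and h: "\<And>v. v < m \<Longrightarrow> v \<noteq> x \<Longrightarrow> h v = m + 1"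
    and nbr_y: "\<And>u. (m, u) \<in> parcs G \<longleftrightarrow> u = x \<or> u = m + 1 \<or> u = m + 2"
    and nbr_t: "\<And>u. (m + 2, u) \<in> parcs G \<longleftrightarrow> u = m"
    and prefix: "(clique_step move m)\<^sup>*\<^sup>* start (x, col)"
    and skip: "move (col x) (clique_env m col x 0) = Go 0 0"
    and colored: "\<And>u. u < m \<Longrightarrow> u \<noteq> x \<Longrightarrow> col u \<noteq> 0" and inj: "inj_on col ({..<m} - {x})"
  shows False
proof -
  note inv = clique_steps_inv[OF prefix]
  have decide_x: "decide move G (x, col) = Go 0 0"
    using inv x hx skip by (simp add: decide_clique)
  have col_x: "col x = 0" using GoE[OF decide_x] by metis
  have arcs_y: "(m, x) \<in> parcs G" "(x, m) \<in> parcs G" "(m, m + 1) \<in> parcs G"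
    using nbr_y arc_sym by auto
  have step_x: "step (x, col) (m, col)"
    using stepI[OF decide_x arcs_y(2)] inv col_x by (simp add: fun_upd_idem)
  have prefix_t: "(\<lambda>s s'. step s s' \<and> fst s \<noteq> m + 2)\<^sup>*\<^sup>* start (x, col)"
    by (rule clique_steps_imp_steps[OF prefix]) auto
  have reach: "step\<^sup>*\<^sup>* start (x, col)"
    by (rule clique_steps_imp_steps[OF prefix]) auto
  then have reach_y: "step\<^sup>*\<^sup>* start (m, col)" using step_x by (rule rtranclp.rtrancl_into_rtrancl)
  have contra: False if A: "(x, col) \<in> A" "\<And>s. s \<in> A \<Longrightarrow> fst s \<noteq> m + 2"
    "\<And>s. s \<in> A \<Longrightarrow> \<exists>s' \<in> A. step s s'" for A
  proof (rule escape'[OF _ prefix_t, of A "{}"])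
    show "m + 2 \<in> pverts G" by (simp add: verts)
  qed (use A in auto)
  show False
  proof (cases "decide move G (m, col)")
    case Stop
    then show False
      using x step_x step_Stop by (intro contra[of "{(x, col), (m, col)}"]) auto
  next
    case (Go k d)
    obtain u where "(m, u) \<in> parcs G" "col u = d" using GoE[OF Go] by metis
    then have d: "d = 0" using nbr_y col_x inv by auto
    consider "k = 0" | w where "w < m" "w \<noteq> x" "col w = k" "k \<noteq> 0" | "k \<noteq> 0" "k \<notin> col ` ({..<m} - {x})"
      by auto
    then show False
    proof cases
      case 1
      \<comment> \<open>Nothing has been colored, so the agent shuttles between \<open>x\<close> and
        \<open>y\<close> forever.\<close>
      then have "step (m, col) (x, col)"
        using stepI[OF Go arcs_y(1)] d col_x inv by (simp add: fun_upd_idem)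
      then show False
        using x step_x by (intro contra[of "{(x, col), (m, col)}"]) auto
    next
      case 2
      \<comment> \<open>Once \<open>y\<close> has color \<open>k\<close>, the agent stays in the
        clique or at \<open>g\<close>. From \<open>x\<close> and \<open>g\<close>, the neighbors of
        \<open>y\<close> other than \<open>t\<close>, a request for \<open>k\<close> is answered
        with \<open>w\<close>.\<close>
      define A where "A = {(p, c'). (p < m \<or> p = m + 1) \<and> c' m = k \<and> c' w = k} \<union> {(x, col), (m, col)}"
      have "\<exists>s' \<in> A. step s s'" if "s \<in> A" for s
      proof -
        from that consider "s = (x, col)" | "s = (m, col)"
          | p c' where "s = (p, c')" "p < m \<or> p = m + 1" "c' m = k" "c' w = k"
          unfolding A_def by blast
        then show ?thesis
        proof cases
          case 1
          then show ?thesis using step_x by (auto simp: A_def)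
        next
          case s: 2
          have "step (m, col) (m + 1, col(m := k))"
            using stepI[OF Go arcs_y(3)] d inv by simp
          then show ?thesis using s 2 by (intro bexI[of _ "(m + 1, col(m := k))"]) (auto simp: A_def)
        next
          case (3 p c')
          show ?thesis
          proof (cases "decide move G s")
            case Stop
            then show ?thesis using that step_Stop by blast
          next
            case (Go c e)
            obtain u where u: "(p, u) \<in> parcs G" "c' u = e" using Go 3(1) GoE by metis
            have arcs_m: "(v, m) \<in> parcs G \<longleftrightarrow> v = x \<or> v = m + 1 \<or> v = m + 2" for v
              using nbr_y arc_sym by blast
            have w_adj: "(x, w) \<in> parcs G" "(m + 1, w) \<in> parcs G"
              using nbr[OF x] nbr[of w] h[of w] 2 arc_sym by auto
            have "\<exists>u. (p, u) \<in> parcs G \<and> c' u = e \<and> u \<noteq> m"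
            proof (cases "u = m")
              case True
              then have "(p, w) \<in> parcs G" using u(1) arcs_m 3 w_adj by auto
              then show ?thesis using True u 3 2 by auto
            qed (use u in blast)
            then obtain u where u: "(p, u) \<in> parcs G" "c' u = e" "u \<noteq> m" by blast
            have "u \<noteq> m + 2" using u(1) nbr_t arc_sym 3(2) by fastforce
            then have "u < m \<or> u = m + 1" using arc_bound[OF u(1)] u(3) by linarith
            moreover have step: "step s (u, c'(p := c))" using stepI Go 3(1) u by blast
            moreover have "(c'(p := c)) z = c' z" if "c' z \<noteq> 0" for z
              using step_keeps[OF step] that 3(1) by auto
            ultimately have "(u, c'(p := c)) \<in> A" using 3 2 by (auto simp: A_def)
            then show ?thesis using step by blast
          qed
        qed
      qed
      then show False using x by (intro contra[of A]) (auto simp: A_def)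
    next
      case 3
      let ?K = "insert k (col ` ({..<m} - {x}))"
      have "card ?K = Suc (card (col ` ({..<m} - {x})))" using 3 by simp
      also have "\<dots> = m" using inj x m_pos by (simp add: card_image)
      finally have "card ?K = m" .
      moreover have "?K \<subseteq> insert k (range col) - {0}" using colored 3 by force
      ultimately show False using card_colors_less[OF reach_y Go] by blast
    qed
  qed
qed

text \<open>
  The case of five vertices: in a triangle with two pendants at one vertex, the adversary can avoid
  the start vertex 0 because vertex 1 has the same color and is adjacent to the same vertices.
\<close>

lemma no_duplicate_in_triangle:
  assumes m: "m = 2" and h: "\<And>v. v < 2 \<Longrightarrow> h v = 2"
    and nbr_p: "\<And>u. (2, u) \<in> parcs G \<longleftrightarrow> u \<in> {0, 1, 3, 4}"
    and nbr_q: "\<And>q u. q = 3 \<or> q = 4 \<Longrightarrow> (q, u) \<in> parcs G \<longleftrightarrow> u = 2"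
    and prefix: "(\<lambda>s s'. step s s' \<and> fst s < 2)\<^sup>*\<^sup>* start (2, col)"
    and dup: "col 0 = a" "col 1 = a" "a \<noteq> 0"
  shows False
proof -
  define loop where "loop \<longleftrightarrow> move a (clique_env 2 (\<lambda>_. a) 0 0) = Go a a"
  \<comment> \<open>The start vertex 0 is entered only if the agent then decides
    \<open>Go a a\<close> there, so it never stops at 0. Reachability is kept for the color
    bound.\<close>
  define B where "B = {(p, c'). step\<^sup>*\<^sup>* start (p, c') \<and> p < 5 \<and> c' 0 = a \<and> c' 1 = a \<and>
    (p = 0 \<longrightarrow> c' 2 = 0 \<and> loop)}"
  have reach: "step\<^sup>*\<^sup>* start (2, col)"
    using prefix by (rule rtranclp_mono[THEN predicate2D, rotated]) auto
  have decide_clique': "decide move G (p, c') = move a (clique_env 2 (\<lambda>_. a) 0 (c' 2))"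
    if "p < 2" "c' 0 = a" "c' 1 = a" for p c'
  proof -
    have "clique_env 2 c' p (c' 2) = clique_env 2 (\<lambda>_. a) p (c' 2)"
      using that by (intro clique_env_cong) (auto simp: less_2_cases_iff)
    also have "\<dots> = clique_env 2 (\<lambda>_. a) 0 (c' 2)"
      using that by (intro clique_env_same_color) auto
    finally show ?thesis using that h[of p] m by (auto simp: decide_clique less_2_cases_iff)
  qed
  have stepB: "\<exists>s' \<in> B. step s s'" if "s \<in> B" for s
  proof (cases "decide move G s")
    case Stop
    then show ?thesis using that step_Stop by blast
  next
    case (Go c d)
    obtain p c' where pc: "s = (p, c')" by (cases s)
    have *: "step\<^sup>*\<^sup>* start (p, c')" "p < 5" "c' 0 = a" "c' 1 = a" "p = 0 \<Longrightarrow> c' 2 = 0" "p = 0 \<Longrightarrow> loop"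
      using that pc by (auto simp: B_def)
    obtain u where u: "(p, u) \<in> parcs G" "c' u = d" "c' p \<noteq> 0 \<Longrightarrow> c = c' p"
      using Go pc GoE by metis
    have move: ?thesis if "(p, u) \<in> parcs G" "c' u = d" "u = 0 \<Longrightarrow> (c'(p := c)) 2 = 0 \<and> loop" for u
    proof -
      have step: "step s (u, c'(p := c))" using stepI Go pc that by blast
      have "(c'(p := c)) 0 = a" "(c'(p := c)) 1 = a"
        using step_keeps[OF step, of 0] step_keeps[OF step, of 1] pc * dup by auto
      moreover have "step\<^sup>*\<^sup>* start (u, c'(p := c))"
        using *(1) step pc by (simp add: rtranclp.rtrancl_into_rtrancl)
      ultimately have "(u, c'(p := c)) \<in> B"
        using that(3) arc_bound[OF that(1)] m by (simp add: B_def)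
      then show ?thesis using step by blast
    qed
    show ?thesis
    proof (cases "u = 0")
      case False
      then show ?thesis using move u by blast
    next
      case True
      then have d: "d = a" using u * by simp
      from True u(1) have "p = 1 \<or> p = 2"
        using nbr[of 0 p] h[of 0] m arc_sym by auto
      then show ?thesis
      proof
        assume p: "p = 2"
        then have "(p, 1) \<in> parcs G" using nbr_p by simp
        then show ?thesis using move d * by simp
      next
        assume p: "p = 1"
        have c: "c = a" using u(3) p * dup by simp
        have decide: "decide move G (p, c') = move a (clique_env 2 (\<lambda>_. a) 0 (c' 2))"
          using decide_clique' p * by simp
        consider "c' 2 = 0" | "c' 2 = a" | "c' 2 \<noteq> 0" "c' 2 \<noteq> a" by blast
        then show ?thesis
        \<comment> \<open>An uncolored vertex 2 makes \<open>loop\<close> true, a vertex 2 of color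
          \<open>a\<close> replaces 0 as the target, and any other color of 2 is a second color,
          against \<open>few\<close>.\<close>
        proof cases
          case 1
          then have loop using decide Go pc c d by (simp add: loop_def)
          then show ?thesis using move[of u] u True p 1 by auto
        next
          case 2
          have "(p, 2) \<in> parcs G" using nbr_p arc_sym p by blast
          then show ?thesis using move[of 2] 2 d by simp
        next
          case 3
          have "{a, c' 2} \<subseteq> insert c (range c') - {0}" using c 3 dup by auto
          then have "card {a, c' 2} \<noteq> 2"
            using card_colors_less[OF *(1), of c d] Go pc m by blast
          then show ?thesis using 3 by simp
        qed
      qed
    qed
  qed
  show False
  \<comment> \<open>The target 2 is visited at once; only the absence of a stop at 0
    matters.\<close>
  proof (rule escape'[of 2 "(2, col)" "{}" B])
    show "(\<lambda>s s'. step s s' \<and> fst s \<noteq> 2)\<^sup>*\<^sup>* start (2, col)"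
      using prefix by (rule rtranclp_mono[THEN predicate2D, rotated]) auto
    show "(2, col) \<in> {} \<union> B" using reach dup by (auto simp: B_def)
    show "decide move G s \<noteq> Stop" if "s \<in> B" "fst s = 0" for s
      using that decide_clique'[of 0 "snd s"] by (cases s) (auto simp: B_def loop_def)
  qed (use stepB verts m in auto)
qed

end

subsection \<open>The lower bound\<close>

theorem theorem6:
  fixes move :: algorithm and n :: nat
  assumes "exploration_algorithm move"
    and "n \<ge> 1"
    and "\<And>G :: nat pair_pre_digraph.
           connected_graph G \<Longrightarrow> card (pverts G) = n \<Longrightarrow> successfully_explores move G"
  shows "\<exists>G :: nat pair_pre_digraph.
           connected_graph G \<and> card (pverts G) = n \<and> uses_at_least_colors move G (n - 3)"
proof (cases "n \<le> 3")
  case True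
  let ?G = "graph_on n (\<lambda>_ _. True)"
  have "(v, 0) \<in> (parcs ?G)\<^sup>*" if "v < n" for v
    using that by (cases "v = 0") (auto simp: parcs_graph_on intro!: r_into_rtrancl)
  then have "connected_graph ?G"
    using assms(2) by (intro connected_graph_on[of 0]) auto
  moreover
  have "\<exists>r k. exploration_run move ?G 0 r \<and> r k = (0, \<lambda>_. 0)"
    using assms(2) pair_graph_graph_on[of n]
    by (intro ex_run_through[OF assms(1)])
      (auto simp: pair_graph_def pair_digraph_def pair_fin_digraph_def pair_fin_digraph_axioms_def)
  then have "uses_at_least_colors move ?G (n - 3)"
    using True unfolding uses_at_least_colors_def by auto
  ultimately show ?thesis by force
next
  case False
  define m where "m = n - 3"
  have n: "n = m + 3" and m_pos: "m > 0" using False by (auto simp: m_def)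
  show ?thesis
  proof (rule ccontr)
    assume neg: "\<not> ?thesis"
    have few: "few_colors move m (clique_with m h F) h"
      if "\<And>v. v < m \<Longrightarrow> m \<le> h v \<and> h v < m + 3"
        "\<And>w. m \<le> w \<Longrightarrow> w < m + 3 \<Longrightarrow> (\<exists>u<m. h u = w) \<or>
          (\<exists>u w'. u < m \<and> h u = w' \<and> m \<le> w' \<and> w' < m + 3 \<and> w \<noteq> w' \<and> (F w w' \<or> F w' w))"
      for h F
    proof -
      note conn = connected_clique_with[OF m_pos that(2)]
      have "clique_graph move m (clique_with m h F) h"
        using clique_graph_clique_with[OF assms(1) m_pos that(1)] assms(3)[OF conn(1)] conn(2) n by simp
      moreover have "\<not> uses_at_least_colors move (clique_with m h F) m"
        using neg conn n by auto
      ultimately show ?thesis by (simp add: few_colors_def few_colors_axioms_def)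
    qed
    define F :: "nat \<Rightarrow> nat \<Rightarrow> bool" where "F u v \<longleftrightarrow> u = m \<and> v > m" for u v
    have skip_few: "few_colors move m (clique_with m (\<lambda>v. if v = x then m else m + 1) F)
        (\<lambda>v. if v = x then m else m + 1)" if "x < m" for x
    proof (rule few)
      fix w assume "m \<le> w" "w < m + 3"
      then consider "w = m" | "w > m" by linarith
      then show "(\<exists>u<m. (if u = x then m else m + 1) = w) \<or>
          (\<exists>u w'. u < m \<and> (if u = x then m else m + 1) = w' \<and> m \<le> w' \<and> w' < m + 3 \<and> w \<noteq> w' \<and>
             (F w w' \<or> F w' w))"
        by cases (use that in \<open>auto simp: F_def intro!: exI[of _ x]\<close>)
    qed auto
    \<comment> \<open>The attached vertex 0 is an arbitrary choice: this graph only serves to find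
      the clique phase, which is replayed below in graphs depending on \<open>v\<close>,
      \<open>i\<close> and \<open>j\<close>.\<close>
    interpret base: few_colors move m "clique_with m (\<lambda>v. if v = 0 then m else m + 1) F"
      "\<lambda>v. if v = 0 then m else m + 1"
      by (rule skip_few[OF m_pos])
    obtain v col c where reach: "(clique_step move m)\<^sup>*\<^sup>* (0, \<lambda>_. 0) (v, col)"
      and go: "move (col v) (clique_env m col v 0) = Go c 0"
      and colored: "\<And>u. u < m \<Longrightarrow> u \<noteq> v \<Longrightarrow> col u \<noteq> 0"
      using base.clique_phase_ends by blast
    note inv = base.clique_steps_inv[OF reach]
    define col' where "col' = col(v := c)"
    have keep: "col v \<noteq> 0 \<Longrightarrow> c = col v"
      using base.GoE[of v col c 0] base.decide_clique[OF inv(1)] go inv by fastforce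
    show False
    \<comment> \<open>Restricted to colored vertices, since \<open>v\<close> may remain
      uncolored.\<close>
    proof (cases "inj_on col' {u. u < m \<and> col' u \<noteq> 0}")
      case inj: True
      show False
      proof (cases "c = 0")
        case True
        with keep have "col v = 0" by blast
        then have "col' = col" using True by (simp add: col'_def fun_upd_idem)
        then have inj': "inj_on col ({..<m} - {v})"
          using inj colored by (auto simp: inj_on_def)
        interpret few_colors move m "clique_with m (\<lambda>u. if u = v then m else m + 1) F"
          "\<lambda>u. if u = v then m else m + 1"
          by (rule skip_few[OF inv(1)])
        show False
        proof (rule no_skip[OF inv(1) _ _ _ _ reach _ colored inj'])
          show "(m, u) \<in> parcs (clique_with m (\<lambda>u. if u = v then m else m + 1) F) \<longleftrightarrow>
              u = v \<or> u = m + 1 \<or> u = m + 2" for u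
            using inv(1) by (auto simp: parcs_clique_with F_def)
          show "(m + 2, u) \<in> parcs (clique_with m (\<lambda>u. if u = v then m else m + 1) F) \<longleftrightarrow> u = m" for u
            by (auto simp: parcs_clique_with F_def)
        qed (use go True in auto)
      next
        case False
        then have "{u. u < m \<and> col' u \<noteq> 0} = {..<m}" using colored by (auto simp: col'_def)
        then have "card (col' ` {..<m}) = m" using inj by (simp add: card_image)
        moreover have "base.step\<^sup>*\<^sup>* base.start (v, col)"
          by (rule base.clique_steps_imp_steps[OF reach]) auto
        moreover have "decide move (clique_with m (\<lambda>v. if v = 0 then m else m + 1) F) (v, col) = Go c 0"
          using base.decide_clique[OF inv(1)] go inv by simp
        moreover have "col' ` {..<m} \<subseteq> insert c (range col) - {0}"
          using colored False by (force simp: col'_def)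
        ultimately show False using base.card_colors_less by blast
      qed
    next
      case False
      \<comment> \<open>At most one of two distinct vertices is \<open>v\<close>, so it can be named
        \<open>i\<close>.\<close>
      then obtain i j where dup: "i < m" "j < m" "i \<noteq> j" "col' i = col' j" "col' i \<noteq> 0" "j \<noteq> v"
        unfolding inj_on_def by (metis (mono_tags, lifting) mem_Collect_eq)
      show False
      proof (cases "m = 2")
        case True
        \<comment> \<open>With \<open>m = 2\<close> no clique vertex would be left to connect the
          third outer vertex. Here \<open>F\<close> hangs both pendants at vertex 2.\<close>
        interpret few_colors move m "clique_with m (\<lambda>_. m) F" "\<lambda>_. m"
        proof (rule few)
          fix w assume "m \<le> w" "w < m + 3"
          then show "(\<exists>u<m. m = w) \<or>
            (\<exists>u w'. u < m \<and> m = w' \<and> m \<le> w' \<and> w' < m + 3 \<and> w \<noteq> w' \<and> (F w w' \<or> F w' w))"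
            using m_pos by (auto simp: F_def)
        qed auto
        have "step (v, col) (m, col')"
          unfolding col'_def using go decide_clique[OF inv(1)] inv
          by (intro stepI) (auto simp: nbr[OF inv(1)])
        then have "step (v, col) (2, col')" using True by simp
        moreover have "(\<lambda>s s'. step s s' \<and> fst s < 2)\<^sup>*\<^sup>* start (v, col)"
          using True by (intro clique_steps_imp_steps[OF reach]) auto
        ultimately have "(\<lambda>s s'. step s s' \<and> fst s < 2)\<^sup>*\<^sup>* start (2, col')"
          using inv(1) True by (auto intro: rtranclp.rtrancl_into_rtrancl)
        moreover have "col' 0 = col' 1" "col' 1 \<noteq> 0"
          using dup True by (auto simp: less_2_cases_iff)
        moreover have "(2, u) \<in> parcs (clique_with m (\<lambda>_. m) F) \<longleftrightarrow> u \<in> {0, 1, 3, 4}" for u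
          using True by (auto simp: parcs_clique_with F_def)
        moreover have "(q, u) \<in> parcs (clique_with m (\<lambda>_. m) F) \<longleftrightarrow> u = 2" if "q = 3 \<or> q = 4" for q u
          using True that by (auto simp: parcs_clique_with F_def)
        ultimately show False
          using no_duplicate_in_triangle[of col' "col' 1"] True by blast
      next
        case m3: False
        define h where "h u = (if u = i then m + 1 else if u = j then m + 2 else m)" for u
        let ?G = "clique_with m h (\<lambda>_ _. False)"
        have few': "few_colors move m ?G h"
        proof (rule few)
          fix w assume w: "m \<le> w" "w < m + 3"
          have "m \<ge> 3" using dup m3 by linarith
          then have "card ({..<m} - {i, j}) > 0" using dup by (simp add: card_Diff_subset)
          then obtain k where "k < m" "k \<noteq> i" "k \<noteq> j" by (auto simp: card_gt_0_iff)
          moreover from w consider "w = m" | "w = m + 1" | "w = m + 2" by linarith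
          ultimately have "\<exists>u<m. h u = w" using dup by cases (auto simp: h_def)
          then show "(\<exists>u<m. h u = w) \<or>
            (\<exists>u w'. u < m \<and> h u = w' \<and> m \<le> w' \<and> w' < m + 3 \<and> w \<noteq> w' \<and> (False \<or> False))"
            by blast
        qed (auto simp: h_def)
        interpret few_colors move m ?G h by (rule few')
        interpret trap move m ?G h i j "m + 1" "m + 2" m
          by unfold_locales (use dup in \<open>auto simp: h_def parcs_clique_with split: if_splits\<close>)
        have avoid: "(\<lambda>s s'. step s s' \<and> fst s \<noteq> m + 1 \<and> fst s \<noteq> m + 2)\<^sup>*\<^sup>* start (v, col)"
          "(\<lambda>s s'. step s s' \<and> fst s \<noteq> m + 2)\<^sup>*\<^sup>* start (v, col)"
          by (rule clique_steps_imp_steps[OF reach]; auto)+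
        show False
        \<comment> \<open>If \<open>v = i\<close>, the duplicate arises in the very step that enters
          the first pendant; otherwise \<open>i\<close> and \<open>j\<close> already share a
          color.\<close>
        proof (cases "v = i")
          case True
          have "step (v, col) (m + 1, col')"
            unfolding col'_def using go decide_clique[OF inv(1)] inv True
            by (intro stepI) (auto simp: nbr wi)
          with avoid(2) have "(\<lambda>s s'. step s s' \<and> fst s \<noteq> m + 2)\<^sup>*\<^sup>* start (m + 1, col')"
            using inv(1) by (auto intro: rtranclp.rtrancl_into_rtrancl)
          moreover have "col' u \<noteq> 0" if "u < m" for u
            using colored[OF that] dup(5) True by (auto simp: col'_def)
          moreover have "col' (m + 1) = 0" "col' (m + 2) = 0"
            using inv by (auto simp: col'_def)
          ultimately show False using no_first_pendant dup(4) by blast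
        next
          case False
          then show False
            using no_duplicate_color[OF avoid(1) inv(1)] dup inv by (auto simp: col'_def)
        qed
      qed
    qed
  qed
qed

end
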